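(* For every $\epsilon>0$ there exist integers $n\ge1$, $k\ge2$, input parameters $\{\lambda_i\}_{i=1}^n,\{\mu_i\}_{i=1}^n,\{v_i\}_{i=1}^n$, and a feasible pair $(X,\boldsymbol\alpha)$ such that the expected sojourn time satisfies $$\tilde f(X,\boldsymbol\alpha)<\epsilon\,\tilde f(\bar X,\bar{\boldsymbol\alpha}),$$ where $(\bar X,\bar{\boldsymbol\alpha})$ is the (feasible) pooling decision $\bar{\boldsymbol\alpha}=(0,\dots,0,1)$ and $\bar X\in[0,1]^{n\times k}$ is the matrix whose last column is all ones and whose other columns are all zeros.
   Context: There are $n$ customer types and $k$ queues. Type $i$ customers arrive as a Poisson process with rate $\lambda_i>0$; their service time under a unit-capacity server is a nonnegative random variable $S_i$ with $\mathbb E[S_i]=1/\mu_i\in(0,\infty)$ and $\mathbb E[S_i^2]=v_i<\infty$. A partition is a vector $\boldsymbol\alpha=(\alpha_1,\dots,\alpha_k)$ with $\alpha_j\ge0$ and $\sum_j\alpha_j=1$. An assignment is $X\in[0,1]^{n\times k}$ with $\sum_{j}X_{ij}=1$ for all $i$. Let $R(\boldsymbol\alpha)=\{j:\alpha_j>0\}$. The pair $(X,\boldsymbol\alpha)$ is feasible if $\alpha_j>\sum_{i}\lambda_iX_{ij}/\mu_i$ for all $j\in R(\boldsymbol\alpha)$ and $X_{ij}=0$ for all $i$ whenever $\alpha_j=0$. The expected sojourn time (waiting plus service) of a feasible pair is $$\tilde f(X,\boldsymbol\alpha)=\frac{1}{2\sum_{i}\lambda_i}\sum_{j\in R(\boldsymbol\alpha)}\left(\frac{\sum_{i}\lambda_iX_{ij}v_i\cdot\sum_{i}X_{ij}\lambda_i}{\alpha_j^2-\alpha_j\sum_{i}\frac{\lambda_iX_{ij}}{\mu_i}}+\frac{2\sum_{i}\frac{\lambda_iX_{ij}}{\mu_i}}{\alpha_j}\right).$$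 *)

theory Defs
  imports "HOL-Probability.Probability"
begin

text \<open>
  Customer types range over \<open>{1..n}\<close> and queues over \<open>{1..k}\<close>.
  Vectors and matrices are functions on \<open>nat\<close>, of which only the values on these ranges matter.
\<close>

text \<open>
  The law \<open>D\<close> of a nonnegative random variable \<open>S\<close> with \<open>E[S] = 1/mu\<close> and \<open>E[S\<^sup>2] = v < \<infinity>\<close>.
  Integrability is stated separately, since the Bochner integral of a non-integrable function is 0.
\<close>

definition service_time_law :: "real measure \<Rightarrow> real \<Rightarrow> real \<Rightarrow> bool" where
  "service_time_law D mu v \<longleftrightarrow>
     prob_space D \<and> sets D = sets borel \<and> (AE s in D. 0 \<le> s) \<and>
     integrable D (\<lambda>s. s) \<and> (\<integral>s. s \<partial>D) = 1 / mu \<and>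
     integrable D (\<lambda>s. s\<^sup>2) \<and> (\<integral>s. s\<^sup>2 \<partial>D) = v"

definition input_parameters ::
  "nat \<Rightarrow> (nat \<Rightarrow> real) \<Rightarrow> (nat \<Rightarrow> real) \<Rightarrow> (nat \<Rightarrow> real) \<Rightarrow> bool" where
  "input_parameters n lam mu v \<longleftrightarrow>
     (\<forall>i\<in>{1..n}. lam i > 0 \<and> mu i > 0 \<and> (\<exists>D. service_time_law D (mu i) (v i)))"

definition partition_vec :: "nat \<Rightarrow> (nat \<Rightarrow> real) \<Rightarrow> bool" where
  "partition_vec k alpha \<longleftrightarrow> (\<forall>j\<in>{1..k}. alpha j \<ge> 0) \<and> (\<Sum>j=1..k. alpha j) = 1"

definition assignment :: "nat \<Rightarrow> nat \<Rightarrow> (nat \<Rightarrow> nat \<Rightarrow> real) \<Rightarrow> bool" where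
  "assignment n k X \<longleftrightarrow>
     (\<forall>i\<in>{1..n}. \<forall>j\<in>{1..k}. 0 \<le> X i j \<and> X i j \<le> 1) \<and>
     (\<forall>i\<in>{1..n}. (\<Sum>j=1..k. X i j) = 1)"

definition active :: "nat \<Rightarrow> (nat \<Rightarrow> real) \<Rightarrow> nat set" where
  "active k alpha = {j\<in>{1..k}. alpha j > 0}"

definition feasible ::
  "nat \<Rightarrow> nat \<Rightarrow> (nat \<Rightarrow> real) \<Rightarrow> (nat \<Rightarrow> real) \<Rightarrow> (nat \<Rightarrow> nat \<Rightarrow> real) \<Rightarrow> (nat \<Rightarrow> real) \<Rightarrow> bool" where
  "feasible n k lam mu X alpha \<longleftrightarrow>
     assignment n k X \<and> partition_vec k alpha \<and>
     (\<forall>j\<in>active k alpha. alpha j > (\<Sum>i=1..n. lam i * X i j / mu i)) \<and>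
     (\<forall>j\<in>{1..k}. alpha j = 0 \<longrightarrow> (\<forall>i\<in>{1..n}. X i j = 0))"

text \<open>
  Waiting time plus service time of an arriving customer, by the Pollaczek--Khinchine formula in
  each M/G/1 queue \<open>j\<close> run at capacity \<open>alpha j\<close>.
\<close>

definition expected_sojourn ::
  "nat \<Rightarrow> nat \<Rightarrow> (nat \<Rightarrow> real) \<Rightarrow> (nat \<Rightarrow> real) \<Rightarrow> (nat \<Rightarrow> real) \<Rightarrow>
   (nat \<Rightarrow> nat \<Rightarrow> real) \<Rightarrow> (nat \<Rightarrow> real) \<Rightarrow> real" where
  "expected_sojourn n k lam mu v X alpha =
     1 / (2 * (\<Sum>i=1..n. lam i)) *
     (\<Sum>j\<in>active k alpha.
        ((\<Sum>i=1..n. lam i * X i j * v i) * (\<Sum>i=1..n. X i j * lam i)) /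
          ((alpha j)\<^sup>2 - alpha j * (\<Sum>i=1..n. lam i * X i j / mu i)) +
        2 * (\<Sum>i=1..n. lam i * X i j / mu i) / alpha j)"

definition pooled_partition :: "nat \<Rightarrow> nat \<Rightarrow> real" where
  "pooled_partition k = (\<lambda>j. if j = k then 1 else 0)"

definition pooled_assignment :: "nat \<Rightarrow> nat \<Rightarrow> nat \<Rightarrow> real" where
  "pooled_assignment k = (\<lambda>i j. if j = k then 1 else 0)"

end

theory Submission
  imports Defs
begin

text \<open>
  Two types with deterministic service times 1 and \<open>M\<close>, each bringing load 1/4. Giving each type
  its own half of the capacity makes every queue M/D/1, whose contribution to the sum in
  \<open>expected_sojourn\<close> depends only on the load, not on the time scale: 3/2 per queue. When pooled, the
  many short jobs wait behind the rare long ones, and the sum exceeds \<open>M / 8\<close>.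
\<close>

text \<open>Under a point mass every Borel function is almost everywhere constant, hence integrable
  with its value at \<open>s\<close> as integral. This realises deterministic service times, where
  the second moment is the square of the mean.\<close>

lemma service_time_law_return:
  fixes s :: real
  assumes "0 \<le> s"
  shows "service_time_law (return borel s) (1 / s) (s\<^sup>2)"
proof -
  interpret prob_space "return borel s"
    by (rule prob_space_return) simp
  have int: "integrable (return borel s) f" if "f \<in> borel_measurable borel" for f :: "real \<Rightarrow> real"
    using that by (intro integrable_const_bound[where B = "\<bar>f s\<bar>"]) (auto simp: AE_return)
  show ?thesis
    unfolding service_time_law_def
    using assms by (auto simp: prob_space_axioms AE_return integral_return int)
qed

theorem proposition2:
  fixes \<epsilon> :: real
  assumes "\<epsilon> > 0"
  shows "\<exists>(n::nat) (k::nat) (lam :: nat \<Rightarrow> real) (mu :: nat \<Rightarrow> real) (v :: nat \<Rightarrow> real)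
           (X :: nat \<Rightarrow> nat \<Rightarrow> real) (alpha :: nat \<Rightarrow> real).
           n \<ge> 1 \<and> k \<ge> 2 \<and> input_parameters n lam mu v \<and>
           feasible n k lam mu X alpha \<and>
           feasible n k lam mu (pooled_assignment k) (pooled_partition k) \<and>
           expected_sojourn n k lam mu v X alpha
             < \<epsilon> * expected_sojourn n k lam mu v (pooled_assignment k) (pooled_partition k)"
proof -
  \<comment> \<open>Solves \<open>\<epsilon> * (M / 8) = 3\<close>, where 3 is the sum over the two
    split queues.\<close>
  define M where "M = 24 / \<epsilon>"
  define s where "s i = (if i = 1 then 1 else M)" for i :: nat
  define lam where "lam i = 1 / (4 * s i)" for i
  define mu where "mu i = 1 / s i" for i
  define v where "v i = (s i)\<^sup>2" for i
  define X where "X i j = (if i = j then 1 else 0 :: real)" for i j :: nat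
  define alpha where "alpha j = (1 / 2 :: real)" for j :: nat
  have M: "M > 0" using assms by (simp add: M_def)
  have two: "{1..2::nat} = {1, 2}" by auto
  have split_active: "active 2 alpha = {1, 2}"
    by (auto simp: active_def alpha_def)
  have pooled_active: "active 2 (pooled_partition 2) = {2}"
    by (auto simp: active_def pooled_partition_def)
  note vals = s_def lam_def mu_def v_def X_def alpha_def
  have params: "input_parameters 2 lam mu v"
    using M service_time_law_return[of 1] service_time_law_return[of M]
    unfolding input_parameters_def two by (auto simp: s_def lam_def mu_def v_def)
  have split_feasible: "feasible 2 2 lam mu X alpha"
    using M unfolding feasible_def assignment_def partition_vec_def split_active two
    by (simp add: vals)
  have pooled_feasible: "feasible 2 2 lam mu (pooled_assignment 2) (pooled_partition 2)"
    using M unfolding feasible_def assignment_def partition_vec_def pooled_active two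
    by (simp add: vals pooled_assignment_def pooled_partition_def)
  \<comment> \<open>The prefactor is common to both sojourn times, so it stays folded and only its
    sign matters. Below it is folded before \<open>two\<close> rewrites the index range of its
    sum.\<close>
  define c where "c = 1 / (2 * (\<Sum>i=1..2. lam i))"
  have c: "c > 0" using M unfolding c_def two by (simp add: vals add_pos_pos)
  have split: "expected_sojourn 2 2 lam mu v X alpha = c * 3"
    using M unfolding expected_sojourn_def split_active c_def[symmetric] unfolding two
    by (simp add: vals power2_eq_square)
  \<comment> \<open>The factor \<open>1 + M\<close> comes from the sum of
    \<open>lam i * v i\<close>, and \<open>1 + 1 / M\<close> from the total arrival rate. Their
    product contains \<open>M\<close>: the second moment of type 2 meets the arrival rate of type 1.
    The summand 1 is the service term at total load 1/2.\<close>
  have pooled: "expected_sojourn 2 2 lam mu v (pooled_assignment 2) (pooled_partition 2)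
      = c * ((1 + M) * (1 + 1 / M) / 8 + 1)"
    using M unfolding expected_sojourn_def pooled_active c_def[symmetric] unfolding two
    by (simp add: vals pooled_assignment_def pooled_partition_def power2_eq_square field_simps)
  have "M / 8 < (1 + M) * (1 + 1 / M) / 8 + 1"
    using M by (simp add: field_simps)
  then have "\<epsilon> * (M / 8) < \<epsilon> * ((1 + M) * (1 + 1 / M) / 8 + 1)"
    using assms by (rule mult_strict_left_mono)
  moreover have "\<epsilon> * (M / 8) = 3"
    using assms by (simp add: M_def)
  ultimately have "c * 3 < c * (\<epsilon> * ((1 + M) * (1 + 1 / M) / 8 + 1))"
    using c by (intro mult_strict_left_mono) simp_all
  then have "expected_sojourn 2 2 lam mu v X alpha
      < \<epsilon> * expected_sojourn 2 2 lam mu v (pooled_assignment 2) (pooled_partition 2)"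
    unfolding split pooled by (simp only: mult.left_commute)
  then show ?thesis
    using params split_feasible pooled_feasible
    by (intro exI[of _ 2] exI[of _ lam] exI[of _ mu] exI[of _ v] exI[of _ X] exI[of _ alpha]) simp
qed

end
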